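(* Let $n$ be even and let $C_n=([n],w)$ be the cycle graph on $n$ vertices with all edge weights equal to $1$ (edges $\{1,2\},\{2,3\},\dots,\{n-1,n\},\{n,1\}$ have weight $1$ and all other pairs weight $0$). Then $\textrm{con-cert}(C_n)\ge n/4$.
   Context: For an $n$-vertex weighted graph $G=(V,w)$ with non-negative weight vector $w\in\mathbb{R}^{\binom{n}{2}}$ (indexed by 2-element subsets of $V$), $\lambda(G)$ is the minimum over $\emptyset\ne S\subsetneq V$ of the total weight of pairs with exactly one endpoint in $S$; $G$ is connected iff $\lambda(G)>0$. $\textrm{con-cert}(G)$ is the minimum $k$ such that there is a matrix $A\in\mathbb{R}^{k\times\binom{n}{2}}$ with the property that for every graph $G'=(V,w')$ with $w'\ge0$, if $Aw=Aw'$ then $\lambda(G')>0$ iff $\lambda(G)>0$. *)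

theory Defs
  imports Complex_Main "HOL-Library.Ramsey"
begin

text \<open>
  A weighted graph on the finite vertex set \<open>V\<close> is given by a weight function on
  \<open>nsets V 2\<close>, the 2-element subsets of \<open>V\<close>; values on any other set are never used.
\<close>

definition nonneg_weight :: "'a set \<Rightarrow> ('a set \<Rightarrow> real) \<Rightarrow> bool" where
  "nonneg_weight V w \<longleftrightarrow> (\<forall>e\<in>nsets V 2. 0 \<le> w e)"

definition cut_weight :: "'a set \<Rightarrow> ('a set \<Rightarrow> real) \<Rightarrow> 'a set \<Rightarrow> real" where
  "cut_weight V w S = (\<Sum>e\<in>{e \<in> nsets V 2. card (e \<inter> S) = 1}. w e)"

text \<open>For a finite \<open>V\<close> with at least two vertices, \<open>Min\<close> is over a finite nonempty set.\<close>

definition min_cut :: "'a set \<Rightarrow> ('a set \<Rightarrow> real) \<Rightarrow> real" where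
  "min_cut V w = Min (cut_weight V w ` {S. S \<noteq> {} \<and> S \<subset> V})"

text \<open>
  A matrix with \<open>k\<close> rows and columns indexed by \<open>nsets V 2\<close> is a function of which only the
  entries \<open>A i e\<close> with \<open>i < k\<close> and \<open>e \<in> nsets V 2\<close> matter.
\<close>

definition mat_app :: "'a set \<Rightarrow> (nat \<Rightarrow> 'a set \<Rightarrow> real) \<Rightarrow> ('a set \<Rightarrow> real) \<Rightarrow> nat \<Rightarrow> real" where
  "mat_app V A w i = (\<Sum>e\<in>nsets V 2. A i e * w e)"

definition con_certificate ::
    "'a set \<Rightarrow> ('a set \<Rightarrow> real) \<Rightarrow> nat \<Rightarrow> (nat \<Rightarrow> 'a set \<Rightarrow> real) \<Rightarrow> bool" where
  "con_certificate V w k A \<longleftrightarrow>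
     (\<forall>w'. nonneg_weight V w' \<longrightarrow> (\<forall>i<k. mat_app V A w i = mat_app V A w' i) \<longrightarrow>
       (min_cut V w' > 0 \<longleftrightarrow> min_cut V w > 0))"

definition con_cert :: "'a set \<Rightarrow> ('a set \<Rightarrow> real) \<Rightarrow> nat" where
  "con_cert V w = (LEAST k. \<exists>A. con_certificate V w k A)"

text \<open>The least element exists: an identity matrix determines all the weights.\<close>

lemma con_certificate_exists:
  assumes "finite V"
  shows "\<exists>A. con_certificate V w (card (nsets V 2)) A"
proof -
  have fin: "finite (nsets V 2)"
    using assms by (rule finite_imp_finite_nsets)
  then obtain f where f: "bij_betw f {0..<card (nsets V 2)} (nsets V 2)"
    using ex_bij_betw_nat_finite by blast
  define A :: "nat \<Rightarrow> 'a set \<Rightarrow> real" where "A = (\<lambda>i e. if e = f i then 1 else 0)"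
  have app: "mat_app V A u i = u (f i)" if "i < card (nsets V 2)" for u i
  proof -
    have "f i \<in> nsets V 2"
      using f that by (auto simp: bij_betw_def)
    moreover have "mat_app V A u i = (\<Sum>e\<in>nsets V 2. if e = f i then u e else 0)"
      unfolding mat_app_def A_def by (intro sum.cong) auto
    ultimately show ?thesis
      using fin by simp
  qed
  have "min_cut V w' = min_cut V w"
    if eq: "\<forall>i<card (nsets V 2). mat_app V A w i = mat_app V A w' i" for w'
  proof -
    have same: "w' e = w e" if e: "e \<in> nsets V 2" for e
    proof -
      have "e \<in> f ` {0..<card (nsets V 2)}"
        using f e by (simp add: bij_betw_def)
      then obtain i where i: "i < card (nsets V 2)" and ei: "e = f i"
        by auto
      show ?thesis
        using eq[rule_format, OF i] app[OF i, of w] app[OF i, of w'] unfolding ei by simp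
    qed
    have "cut_weight V w' = cut_weight V w"
      unfolding cut_weight_def using same by (intro ext sum.cong) simp_all
    then show ?thesis
      by (simp add: min_cut_def)
  qed
  then have "min_cut V w' > 0 \<longleftrightarrow> min_cut V w > 0"
    if "\<forall>i<card (nsets V 2). mat_app V A w i = mat_app V A w' i" for w'
    using that by (simp only:)
  then have "con_certificate V w (card (nsets V 2)) A"
    unfolding con_certificate_def by blast
  then show ?thesis by blast
qed

definition cycle_edges :: "nat \<Rightarrow> nat set set" where
  "cycle_edges n = {{i, i + 1} | i. 1 \<le> i \<and> i < n} \<union> {{n, 1}}"

definition cycle_weight :: "nat \<Rightarrow> nat set \<Rightarrow> real" where
  "cycle_weight n e = (if e \<in> cycle_edges n then 1 else 0)"

end

theory Submission imports Defs begin

text \<open>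
  If \<open>I\<close> is an independent set of a connected graph, then a certificate needs at least \<open>card I\<close>
  rows: with fewer rows, the images under \<open>A\<close> of the stars at the vertices of \<open>I\<close> satisfy a
  nontrivial linear relation with coefficients \<open>c\<close>. Scaling the star at \<open>j \<in> I\<close> by \<open>1 - c j / c v\<close>,
  where \<open>c v > 0\<close> is the largest coefficient, keeps the weights non-negative and the image under \<open>A\<close>
  unchanged, but isolates \<open>v\<close>. The even vertices of an even cycle form an independent set.
\<close>

text \<open>Gaussian elimination, one equation per induction step: either the last equation vanishes
  on \<open>I\<close>, or it has a pivot \<open>p\<close> and eliminates that unknown, which leaves
  one equation and one unknown fewer.\<close>

lemma underdetermined_homogeneous_system:
  fixes b :: "nat \<Rightarrow> 'a \<Rightarrow> 'b::field"
  assumes "finite I" "k < card I"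
  shows "\<exists>c. (\<exists>j\<in>I. c j \<noteq> 0) \<and> (\<forall>i<k. (\<Sum>j\<in>I. b i j * c j) = 0)"
  using assms
proof (induction k arbitrary: I b)
  case 0
  then have "I \<noteq> {}" by auto
  then show ?case by (intro exI[of _ "\<lambda>_. 1"]) auto
next
  case (Suc k)
  show ?case
  proof (cases "\<forall>j\<in>I. b k j = 0")
    case True
    obtain c where c: "\<exists>j\<in>I. c j \<noteq> 0" "\<forall>i<k. (\<Sum>j\<in>I. b i j * c j) = 0"
      using Suc.IH[of I b] Suc.prems by auto
    have "(\<Sum>j\<in>I. b k j * c j) = 0"
      using True by (intro sum.neutral) simp
    with c show ?thesis by (auto simp: less_Suc_eq)
  next
    case False
    then obtain p where p: "p \<in> I" "b k p \<noteq> 0" by blast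
    \<comment> \<open>Solving equation \<open>k\<close> for unknown \<open>p\<close> and
      substituting into equation \<open>i\<close> leaves these coefficients.\<close>
    define b' where "b' i j = b i j - b i p * b k j / b k p" for i j
    have "finite (I - {p})" "k < card (I - {p})"
      using Suc.prems p by auto
    from Suc.IH[OF this, of b'] obtain c where
      c: "\<exists>j\<in>I - {p}. c j \<noteq> 0" "\<forall>i<k. (\<Sum>j\<in>I - {p}. b' i j * c j) = 0"
      by blast
    define s where "s = (\<Sum>j\<in>I - {p}. b k j * c j)"
    \<comment> \<open>The value at \<open>p\<close> is forced by equation \<open>k\<close>.\<close>
    define d where "d = c(p := - s / b k p)"
    have split: "(\<Sum>j\<in>I. b i j * d j) = (\<Sum>j\<in>I - {p}. b i j * c j) - b i p * s / b k p" for i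
    proof -
      have "(\<Sum>j\<in>I - {p}. b i j * d j) = (\<Sum>j\<in>I - {p}. b i j * c j)"
        unfolding d_def by (intro sum.cong) auto
      then show ?thesis
        using p Suc.prems by (simp add: sum.remove[of I p] d_def)
    qed
    have "(\<Sum>j\<in>I. b i j * d j) = 0" if "i < Suc k" for i
    proof (cases "i = k")
      case True
      then show ?thesis using split[of k] p by (simp add: s_def)
    next
      case False
      have "b i p * s / b k p = (\<Sum>j\<in>I - {p}. b i p * b k j / b k p * c j)"
        unfolding s_def by (simp add: sum_distrib_left sum_divide_distrib mult.assoc)
      then have "(\<Sum>j\<in>I. b i j * d j) = (\<Sum>j\<in>I - {p}. b' i j * c j)"
        using split[of i] by (simp add: b'_def sum_subtractf left_diff_distrib)
      then show ?thesis using c False that by simp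
    qed
    moreover have "\<exists>j\<in>I. d j \<noteq> 0"
      using c unfolding d_def by auto
    ultimately show ?thesis by blast
  qed
qed

lemma min_cut_le:
  assumes "finite V" "S \<noteq> {}" "S \<subset> V"
  shows "min_cut V w \<le> cut_weight V w S"
proof -
  have "finite {S. S \<noteq> {} \<and> S \<subset> V}"
    using assms(1) by (rule finite_subset[rotated, OF finite_Pow_iff[THEN iffD2]]) auto
  then show ?thesis
    unfolding min_cut_def using assms by (intro Min_le) auto
qed

lemma min_cut_pos:
  assumes "finite V" "2 \<le> card V"
    and pos: "\<And>S. S \<noteq> {} \<Longrightarrow> S \<subset> V \<Longrightarrow> 0 < cut_weight V w S"
  shows "0 < min_cut V w"
proof -
  have "finite {S. S \<noteq> {} \<and> S \<subset> V}"
    using assms(1) by (rule finite_subset[rotated, OF finite_Pow_iff[THEN iffD2]]) auto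
  moreover obtain v where "v \<in> V" using assms by fastforce
  then have "{v} \<in> {S. S \<noteq> {} \<and> S \<subset> V}" using assms by auto
  ultimately show ?thesis
    unfolding min_cut_def using pos by (subst Min_gr_iff) auto
qed

lemma con_certificate_card_independent_le:
  assumes V: "finite V" "2 \<le> card V" "I \<subseteq> V"
    and nonneg: "nonneg_weight V w" and conn: "0 < min_cut V w"
    and indep: "\<And>e. e \<in> nsets V 2 \<Longrightarrow> w e \<noteq> 0 \<Longrightarrow> \<not> e \<subseteq> I"
    and cert: "con_certificate V w k A"
  shows "card I \<le> k"
proof (rule ccontr)
  assume "\<not> card I \<le> k"
  then have k: "k < card I" by simp
  have fin: "finite I" using V finite_subset by blast
  \<comment> \<open>\<open>b i j\<close> is entry \<open>i\<close> of the image under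
    \<open>A\<close> of the star at \<open>j\<close>, that is, of \<open>w\<close> restricted to the
    pairs containing \<open>j\<close>.\<close>
  define b where "b i j = (\<Sum>e\<in>nsets V 2. A i e * (w e * of_bool (j \<in> e)))" for i j
  obtain c0 where c0: "\<exists>j\<in>I. c0 j \<noteq> 0" "\<forall>i<k. (\<Sum>j\<in>I. b i j * c0 j) = 0"
    using underdetermined_homogeneous_system[OF fin k] by blast
  \<comment> \<open>Relations may be negated, so some coefficient can be taken positive; the largest
    one is then a legitimate divisor.\<close>
  obtain c where c: "\<exists>j\<in>I. c j > 0" "\<forall>i<k. (\<Sum>j\<in>I. b i j * c j) = 0"
  proof (cases "\<exists>j\<in>I. c0 j > 0")
    case True
    then show ?thesis using c0 that by blast
  next
    case False
    with c0 have "\<exists>j\<in>I. - c0 j > 0" by (meson linorder_neqE_linordered_idom neg_0_less_iff_less)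
    then show ?thesis using c0 that[of "\<lambda>j. - c0 j"] by (simp add: sum_negf)
  qed
  have "I \<noteq> {}" using c by blast
  then obtain v where v: "v \<in> I" "c v = Max (c ` I)"
    using Max_in[of "c ` I"] fin by fastforce
  have le: "c j \<le> c v" if "j \<in> I" for j
    unfolding v(2) using fin that by simp
  have cv: "0 < c v" using c le by fastforce
  \<comment> \<open>\<open>f e\<close> adds up the coefficients of the endpoints of \<open>e\<close>
    in \<open>I\<close>, so \<open>w e * f e\<close> is the combination of the stars with
    coefficients \<open>c\<close>.\<close>
  define f where "f e = (\<Sum>j\<in>I. of_bool (j \<in> e) * c j)" for e
  define w' where "w' e = w e * (1 - f e / c v)" for e
  have f_inter: "f e = sum c (I \<inter> e)" for e
    unfolding f_def using fin by (simp add: if_distrib sum.If_cases of_bool_def if_distribR Int_def)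
  \<comment> \<open>Independence enters here: a pair of nonzero weight lies in at most one of the
    stars, so \<open>f\<close> is a single coefficient or zero on it and never exceeds
    \<open>c v\<close>.\<close>
  have single: "I \<inter> e \<subseteq> {j}" if e: "e \<in> nsets V 2" "w e \<noteq> 0" and j: "j \<in> I \<inter> e" for e j
  proof -
    have "card e = 2" using e by (simp add: nsets_def)
    then obtain x y where "e = {x, y}" by (auto simp: card_2_iff)
    then show ?thesis using indep[OF e] j by blast
  qed
  have f_single: "f e = c j" if "e \<in> nsets V 2" "w e \<noteq> 0" "j \<in> I \<inter> e" for e j
  proof -
    have "I \<inter> e = {j}" using single[OF that] that by blast
    then show ?thesis by (simp add: f_inter)
  qed
  have "0 \<le> w' e" if e: "e \<in> nsets V 2" for e
  proof (cases "w e = 0")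
    case False
    have "f e \<le> c v"
    proof (cases "I \<inter> e = {}")
      case True
      then show ?thesis using cv by (simp add: f_inter)
    next
      case False
      then obtain j where "j \<in> I \<inter> e" by blast
      then show ?thesis using f_single[OF e \<open>w e \<noteq> 0\<close>] le by simp
    qed
    then have "0 \<le> 1 - f e / c v" using cv by simp
    then show ?thesis
      using nonneg e unfolding w'_def nonneg_weight_def by simp
  qed (simp add: w'_def)
  then have "nonneg_weight V w'" by (simp add: nonneg_weight_def)
  moreover have "mat_app V A w i = mat_app V A w' i" if "i < k" for i
  proof -
    \<comment> \<open>Exchanging the sums turns the image of \<open>w e * f e\<close> into the
      linear relation among the images of the stars.\<close>
    have "(\<Sum>e\<in>nsets V 2. A i e * (w e * f e)) = (\<Sum>e\<in>nsets V 2. \<Sum>j\<in>I. A i e * (w e * of_bool (j \<in> e)) * c j)"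
      unfolding f_def by (simp add: sum_distrib_left mult.assoc)
    also have "\<dots> = (\<Sum>j\<in>I. b i j * c j)"
      unfolding b_def sum_distrib_right by (rule sum.swap)
    also have "\<dots> = 0" using c that by blast
    finally have 0: "(\<Sum>e\<in>nsets V 2. A i e * (w e * f e)) = 0" .
    have "mat_app V A w' i = mat_app V A w i - (\<Sum>e\<in>nsets V 2. A i e * (w e * f e)) / c v"
      unfolding mat_app_def w'_def
      by (simp add: sum_divide_distrib sum_subtractf[symmetric] right_diff_distrib)
    then show ?thesis using 0 by simp
  qed
  ultimately have "0 < min_cut V w'"
    using cert conn unfolding con_certificate_def by blast
  moreover have "min_cut V w' \<le> cut_weight V w' {v}"
    using V v by (intro min_cut_le) auto
  moreover have "cut_weight V w' {v} = 0"
    unfolding cut_weight_def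
  proof (intro sum.neutral ballI)
    fix e assume "e \<in> {e \<in> nsets V 2. card (e \<inter> {v}) = 1}"
    then have e: "e \<in> nsets V 2" "v \<in> e" by (cases "v \<in> e"; simp)+
    show "w' e = 0"
    proof (cases "w e = 0")
      case False
      then have "f e = c v" using f_single e v by blast
      then show ?thesis using cv by (simp add: w'_def)
    qed (simp add: w'_def)
  qed
  ultimately show False by simp
qed

lemma con_certificate_con_cert:
  assumes "finite V"
  shows "\<exists>A. con_certificate V w (con_cert V w) A"
  unfolding con_cert_def
  by (rule LeastI_ex) (use con_certificate_exists[OF assms] in blast)

text \<open>Along 1, ..., \<open>n\<close>, membership in \<open>S\<close> must change between some
  \<open>i\<close> and \<open>i + 1\<close>, and the edge joining them crosses the cut. Otherwise
  \<open>S\<close> would be empty or everything.\<close>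

lemma min_cut_cycle_pos:
  assumes "2 \<le> n"
  shows "0 < min_cut {1..n} (cycle_weight n)"
proof (rule min_cut_pos)
  fix S :: "nat set" assume S: "S \<noteq> {}" "S \<subset> {1..n}"
  obtain i where i: "1 \<le> i" "i < n" "i \<in> S \<longleftrightarrow> i + 1 \<notin> S"
  proof (rule ccontr)
    assume "\<not> thesis"
    then have step: "i + 1 \<in> S \<longleftrightarrow> i \<in> S" if "1 \<le> i" "i < n" for i
      using that \<open>\<And>i. 1 \<le> i \<Longrightarrow> i < n \<Longrightarrow> i \<in> S \<longleftrightarrow> i + 1 \<notin> S \<Longrightarrow> thesis\<close> by blast
    have "j \<le> n \<longrightarrow> (j \<in> S \<longleftrightarrow> 1 \<in> S)" if "1 \<le> j" for j
      using that by (induction j rule: dec_induct) (use step in auto)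
    then show False
      using S by (metis atLeastAtMost_iff psubsetE subsetD subsetI equals0I order_refl antisym)
  qed
  define e where "e = {i, i + 1}"
  have "e \<in> nsets {1..n} 2" "e \<in> cycle_edges n"
    using i by (auto simp: e_def nsets_def cycle_edges_def)
  moreover have "e \<inter> S = {if i \<in> S then i else i + 1}"
    using i by (auto simp: e_def)
  ultimately show "0 < cut_weight {1..n} (cycle_weight n) S"
    unfolding cut_weight_def
    by (intro sum_pos2[of _ e]) (auto simp: cycle_weight_def finite_imp_finite_nsets)
qed (use assms in auto)

theorem theorem26:
  fixes n :: nat
  assumes "even n"
  shows "real (con_cert {1..n} (cycle_weight n)) \<ge> real n / 4"
proof (cases "n = 0")
  case False
  with assms have n: "2 \<le> n" by (auto elim: evenE)
  define I where "I = {j \<in> {1..n}. even j}"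
  have "I = (\<lambda>j. 2 * j) ` {1..n div 2}"
    by (auto simp: I_def image_iff elim!: evenE)
  then have card: "card I = n div 2"
    by (simp add: card_image inj_on_def)
  obtain A where "con_certificate {1..n} (cycle_weight n) (con_cert {1..n} (cycle_weight n)) A"
    using con_certificate_con_cert[of "{1..n}"] by blast
  moreover have "nonneg_weight {1..n} (cycle_weight n)"
    by (simp add: nonneg_weight_def cycle_weight_def)
  \<comment> \<open>Every cycle edge has an odd endpoint: one of \<open>i\<close> and
    \<open>i + 1\<close>, or 1 in the closing edge.\<close>
  moreover have "\<not> e \<subseteq> I" if "cycle_weight n e \<noteq> 0" for e
    using that by (auto simp: cycle_weight_def cycle_edges_def I_def split: if_splits)
  moreover have "I \<subseteq> {1..n}" by (auto simp: I_def)
  ultimately have "card I \<le> con_cert {1..n} (cycle_weight n)"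
    using n min_cut_cycle_pos[OF n]
    by (intro con_certificate_card_independent_le[of "{1..n}" I "cycle_weight n"]) auto
  \<comment> \<open>The independent set gives \<open>n / 2\<close>, twice the required
    bound.\<close>
  then have "real n / 2 \<le> real (con_cert {1..n} (cycle_weight n))"
    using assms unfolding card by (elim evenE) simp
  then show ?thesis by simp
qed simp

end
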